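(* Let $\beta>0$ and $\gamma\ge0$, and consider the linear-quadratic jump-diffusion control problem described in the context. Let $\boldsymbol H:[0,\infty)\to\mathbb S^d$ and $g_\gamma:[0,\infty)\to\mathbb R$ be continuously differentiable and put $V(t,\boldsymbol x)=\boldsymbol x^\top\boldsymbol H(t)\boldsymbol x+g_\gamma(t)$. (a) Case $\gamma>0$. For every $(t,\boldsymbol x)$ the supremum over policies in the entropy-regularized HJB equation for $V$ is attained by the Gaussian policy $$\pi^*(\cdot\mid t,\boldsymbol x)=\mathcal N\Big(\boldsymbol R(t)^{-1}\boldsymbol B(t)^\top\boldsymbol H(t)\boldsymbol x,\ \tfrac\gamma2\boldsymbol R(t)^{-1}\Big),$$ and $V$ satisfies the entropy-regularized HJB equation on $[0,\infty)\times\mathbb R^d$ if and only if $$\boldsymbol H'(t)=\beta\boldsymbol H(t)+\boldsymbol Q(t)-\boldsymbol H(t)\boldsymbol B(t)\boldsymbol R(t)^{-1}\boldsymbol B(t)^\top\boldsymbol H(t),$$ $$g_\gamma'(t)=\beta g_\gamma(t)-\mathrm{Tr}\big(\boldsymbol\Sigma(t)\boldsymbol\Sigma(t)^\top\boldsymbol H(t)\big)-\mathrm{Tr}\big(\boldsymbol\Lambda(t)\,\mathrm{diag}(\boldsymbol\alpha(t))\,\boldsymbol H(t)\,\mathrm{diag}(\boldsymbol\alpha(t))\big)-c_\gamma(t),$$ where $c_\gamma(t)=\frac\gamma2\big(m\log(\pi\gamma)-\log\det\boldsymbol R(t)\big)$ (here $\pi$ is the number $3.14\ldots$) and $\boldsymbol\Lambda(t)=\mathrm{diag}(\lambda_1(t),\dots,\lambda_d(t))$.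 (b) Case $\gamma=0$. The supremum in the standard HJB equation for $V$ is attained at the feedback control $\boldsymbol u^*(t,\boldsymbol x)=\boldsymbol R(t)^{-1}\boldsymbol B(t)^\top\boldsymbol H(t)\boldsymbol x$, and $V$ satisfies the standard HJB equation if and only if $(\boldsymbol H,g_0)$ satisfies the two equations of (a) with $c_\gamma(t)$ replaced by $0$.
   Context: State dynamics: $d\boldsymbol X_t=\boldsymbol B(t)\boldsymbol u_t\,dt+\boldsymbol\Sigma(t)\,d\boldsymbol W_t+\sum_{i=1}^d\alpha_i(t)\boldsymbol e_i\,dM^{(i)}_t$, with state in $\mathbb R^d$, control $\boldsymbol u_t\in\mathbb R^m$ (unconstrained), $\boldsymbol W$ a $d$-dimensional Brownian motion, $\boldsymbol e_i$ the canonical basis vectors of $\mathbb R^d$, and $M^{(i)}$ independent compensated Poisson processes with intensities $\lambda_i(t)>0$, independent of $\boldsymbol W$. Here $\boldsymbol B(t)\in\mathbb R^{d\times m}$, $\boldsymbol\Sigma(t)\in\mathbb R^{d\times d}$, $\boldsymbol\alpha(t)=(\alpha_1(t),\dots,\alpha_d(t))^\top\in\mathbb R^d$. $\mathbb S^k$ is the space of real symmetric $k\times k$ matrices. The running reward is $f(t,\boldsymbol x,\boldsymbol u)=-(\boldsymbol u^\top\boldsymbol R(t)\boldsymbol u+\boldsymbol x^\top\boldsymbol Q(t)\boldsymbol x)$ with $\boldsymbol R(t)\in\mathbb S^m$ positive definite and $\boldsymbol Q(t)\in\mathbb S^d$ positive semidefinite. The objective is the infinite-horizon reward discounted at rate $\beta$,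 with Shannon entropy of the policy added with weight $\gamma$ when $\gamma>0$. Hamiltonian: for smooth $V$, $$\mathscr H_V(t,\boldsymbol x,\boldsymbol u)=(\boldsymbol B(t)\boldsymbol u)\cdot\nabla_{\boldsymbol x}V+\tfrac12\mathrm{Tr}(\boldsymbol\Sigma(t)\boldsymbol\Sigma(t)^\top\nabla^2_{\boldsymbol x}V)+\sum_{i=1}^d\lambda_i(t)\big(V(t,\boldsymbol x+\alpha_i(t)\boldsymbol e_i)-V(t,\boldsymbol x)-\alpha_i(t)\partial_{x_i}V(t,\boldsymbol x)\big)+f(t,\boldsymbol x,\boldsymbol u).$$ Entropy-regularized HJB equation ($\gamma>0$): $$0=\partial_tV(t,\boldsymbol x)+\sup_{\pi}\int_{\mathbb R^m}\big[\mathscr H_V(t,\boldsymbol x,\boldsymbol u)-\gamma\log\pi(\boldsymbol u)\big]\pi(\boldsymbol u)\,d\boldsymbol u-\beta V(t,\boldsymbol x),$$ the supremum being over probability densities $\pi$ on $\mathbb R^m$ for which the integral is well defined (finite second moment and integrable $\pi\log\pi$). Standard HJB equation ($\gamma=0$): $0=\partial_tV(t,\boldsymbol x)+\sup_{\boldsymbol u\in\mathbb R^m}\mathscr H_V(t,\boldsymbol x,\boldsymbol u)-\beta V(t,\boldsymbol x)$. *)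

theory Defs
  imports "HOL-Analysis.Analysis"
begin

definition sym_mat :: "real ^ 'n ^ 'n \<Rightarrow> bool" where
  "sym_mat A \<longleftrightarrow> transpose A = A"

definition pos_def :: "real ^ 'n ^ 'n \<Rightarrow> bool" where
  "pos_def A \<longleftrightarrow> sym_mat A \<and> (\<forall>v. v \<noteq> 0 \<longrightarrow> 0 < v \<bullet> (A *v v))"

definition pos_semidef :: "real ^ 'n ^ 'n \<Rightarrow> bool" where
  "pos_semidef A \<longleftrightarrow> sym_mat A \<and> (\<forall>v. 0 \<le> v \<bullet> (A *v v))"

definition diag_mat :: "real ^ 'n \<Rightarrow> real ^ 'n ^ 'n" where
  "diag_mat v = (\<chi> i j. if i = j then v $ i else 0)"

definition gradient :: "(real ^ 'n \<Rightarrow> real) \<Rightarrow> real ^ 'n \<Rightarrow> real ^ 'n" where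
  "gradient f x = (THE D. GDERIV f x :> D)"

definition hessian :: "(real ^ 'n \<Rightarrow> real) \<Rightarrow> real ^ 'n \<Rightarrow> real ^ 'n ^ 'n" where
  "hessian f x = jacobian (gradient f) (at x)"

text \<open>
  Functions of time are total on the reals, but only times in \<open>[0, \<infinity>)\<close> matter:
  derivatives are taken within \<open>{0..}\<close>, so they are one-sided at time 0.
\<close>

definition cont_diff :: "(real \<Rightarrow> 'a::real_normed_vector) \<Rightarrow> bool" where
  "cont_diff F \<longleftrightarrow>
     (\<exists>F'. (\<forall>t\<ge>0. (F has_vector_derivative F' t) (at t within {0..})) \<and> continuous_on {0..} F')"

definition time_deriv :: "(real \<Rightarrow> real ^ 'd \<Rightarrow> real) \<Rightarrow> real \<Rightarrow> real ^ 'd \<Rightarrow> real" where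
  "time_deriv V t x = vector_derivative (\<lambda>s. V s x) (at t within {0..})"

text \<open>
  Coefficients of the controlled jump diffusion
  \<open>dX = B(t) u dt + \<Sigma>(t) dW + (\<Sum>i. \<alpha>\<^sub>i(t) e\<^sub>i dM\<^sup>i)\<close>, where \<open>M\<^sup>i\<close> is a compensated
  Poisson process with intensity \<open>\<lambda>\<^sub>i(t)\<close>, and of the running reward
  \<open>- (u\<^sup>T R(t) u + x\<^sup>T Q(t) x)\<close>.
\<close>

record ('d::finite, 'm::finite) lq_problem =
  ctrl_mat :: "real \<Rightarrow> real ^ 'm ^ 'd"    \<comment> \<open>\<open>B\<close>\<close>
  diff_mat :: "real \<Rightarrow> real ^ 'd ^ 'd"    \<comment> \<open>\<open>\<Sigma>\<close>\<close>
  jump_size :: "real \<Rightarrow> real ^ 'd"        \<comment> \<open>\<open>\<alpha>\<close>\<close>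
  jump_rate :: "real \<Rightarrow> real ^ 'd"        \<comment> \<open>\<open>\<lambda>\<close>\<close>
  ctrl_cost :: "real \<Rightarrow> real ^ 'm ^ 'm"   \<comment> \<open>\<open>R\<close>\<close>
  state_cost :: "real \<Rightarrow> real ^ 'd ^ 'd"  \<comment> \<open>\<open>Q\<close>\<close>

definition lq_wf :: "('d::finite, 'm::finite) lq_problem \<Rightarrow> bool" where
  "lq_wf P \<longleftrightarrow>
     (\<forall>t\<ge>0. (\<forall>i. 0 < jump_rate P t $ i) \<and> pos_def (ctrl_cost P t) \<and> pos_semidef (state_cost P t))"

definition running_reward ::
  "('d::finite, 'm::finite) lq_problem \<Rightarrow> real \<Rightarrow> real ^ 'd \<Rightarrow> real ^ 'm \<Rightarrow> real" where
  "running_reward P t x u = - (u \<bullet> (ctrl_cost P t *v u) + x \<bullet> (state_cost P t *v x))"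

definition hamiltonian ::
  "('d::finite, 'm::finite) lq_problem \<Rightarrow> (real \<Rightarrow> real ^ 'd \<Rightarrow> real)
     \<Rightarrow> real \<Rightarrow> real ^ 'd \<Rightarrow> real ^ 'm \<Rightarrow> real" where
  "hamiltonian P V t x u =
     (ctrl_mat P t *v u) \<bullet> gradient (V t) x
     + 1 / 2 * trace (diff_mat P t ** transpose (diff_mat P t) ** hessian (V t) x)
     + (\<Sum>i\<in>UNIV. jump_rate P t $ i *
          (V t (x + jump_size P t $ i *\<^sub>R axis i 1) - V t x
           - jump_size P t $ i * gradient (V t) x $ i))
     + running_reward P t x u"

text \<open>At points where \<open>p u = 0\<close> the factor \<open>p u\<close> enforces the convention \<open>0 log 0 = 0\<close>.\<close>

definition policies :: "(real ^ 'm \<Rightarrow> real) set" where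
  "policies = {p. (\<forall>u. 0 \<le> p u) \<and> has_bochner_integral lborel p 1
                \<and> integrable lborel (\<lambda>u. (norm u)\<^sup>2 * p u)
                \<and> integrable lborel (\<lambda>u. p u * ln (p u))}"

definition policy_value ::
  "('d::finite, 'm::finite) lq_problem \<Rightarrow> real \<Rightarrow> (real \<Rightarrow> real ^ 'd \<Rightarrow> real)
     \<Rightarrow> real \<Rightarrow> real ^ 'd \<Rightarrow> (real ^ 'm \<Rightarrow> real) \<Rightarrow> real" where
  "policy_value P \<gamma> V t x p =
     (LINT u|lborel. (hamiltonian P V t x u - \<gamma> * ln (p u)) * p u)"

text \<open>Suprema are taken in the extended reals, so that they are meaningful even when infinite.\<close>

definition policy_sup ::
  "('d::finite, 'm::finite) lq_problem \<Rightarrow> real \<Rightarrow> (real \<Rightarrow> real ^ 'd \<Rightarrow> real)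
     \<Rightarrow> real \<Rightarrow> real ^ 'd \<Rightarrow> ereal" where
  "policy_sup P \<gamma> V t x = (SUP p\<in>policies. ereal (policy_value P \<gamma> V t x p))"

definition control_sup ::
  "('d::finite, 'm::finite) lq_problem \<Rightarrow> (real \<Rightarrow> real ^ 'd \<Rightarrow> real)
     \<Rightarrow> real \<Rightarrow> real ^ 'd \<Rightarrow> ereal" where
  "control_sup P V t x = (SUP u. ereal (hamiltonian P V t x u))"

definition entropy_HJB ::
  "('d::finite, 'm::finite) lq_problem \<Rightarrow> real \<Rightarrow> real \<Rightarrow> (real \<Rightarrow> real ^ 'd \<Rightarrow> real) \<Rightarrow> bool" where
  "entropy_HJB P \<beta> \<gamma> V \<longleftrightarrow>
     (\<forall>t\<ge>0. \<forall>x. 0 = ereal (time_deriv V t x) + policy_sup P \<gamma> V t x - ereal (\<beta> * V t x))"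

definition standard_HJB ::
  "('d::finite, 'm::finite) lq_problem \<Rightarrow> real \<Rightarrow> (real \<Rightarrow> real ^ 'd \<Rightarrow> real) \<Rightarrow> bool" where
  "standard_HJB P \<beta> V \<longleftrightarrow>
     (\<forall>t\<ge>0. \<forall>x. 0 = ereal (time_deriv V t x) + control_sup P V t x - ereal (\<beta> * V t x))"

definition gaussian_density :: "real ^ 'm \<Rightarrow> real ^ 'm ^ 'm \<Rightarrow> real ^ 'm \<Rightarrow> real" where
  "gaussian_density \<mu> S u =
     exp (- (1 / 2) * ((u - \<mu>) \<bullet> (matrix_inv S *v (u - \<mu>)))) / sqrt ((2 * pi) ^ CARD('m) * det S)"

definition quad_value ::
  "(real \<Rightarrow> real ^ 'd ^ 'd) \<Rightarrow> (real \<Rightarrow> real) \<Rightarrow> real \<Rightarrow> real ^ 'd \<Rightarrow> real" where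
  "quad_value H g t x = x \<bullet> (H t *v x) + g t"

definition feedback ::
  "('d::finite, 'm::finite) lq_problem \<Rightarrow> (real \<Rightarrow> real ^ 'd ^ 'd) \<Rightarrow> real \<Rightarrow> real ^ 'd \<Rightarrow> real ^ 'm" where
  "feedback P H t x = (matrix_inv (ctrl_cost P t) ** transpose (ctrl_mat P t) ** H t) *v x"

definition riccati_eq ::
  "('d::finite, 'm::finite) lq_problem \<Rightarrow> real \<Rightarrow> (real \<Rightarrow> real ^ 'd ^ 'd) \<Rightarrow> bool" where
  "riccati_eq P \<beta> H \<longleftrightarrow>
     (\<forall>t\<ge>0. (H has_vector_derivative
        (\<beta> *\<^sub>R H t + state_cost P t
         - H t ** ctrl_mat P t ** matrix_inv (ctrl_cost P t) ** transpose (ctrl_mat P t) ** H t))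
        (at t within {0..}))"

definition offset_eq ::
  "('d::finite, 'm::finite) lq_problem \<Rightarrow> real \<Rightarrow> (real \<Rightarrow> real) \<Rightarrow> (real \<Rightarrow> real ^ 'd ^ 'd)
     \<Rightarrow> (real \<Rightarrow> real) \<Rightarrow> bool" where
  "offset_eq P \<beta> c H g \<longleftrightarrow>
     (\<forall>t\<ge>0. (g has_real_derivative
        (\<beta> * g t - trace (diff_mat P t ** transpose (diff_mat P t) ** H t)
         - trace (diag_mat (jump_rate P t) ** diag_mat (jump_size P t) ** H t
                  ** diag_mat (jump_size P t))
         - c t))
        (at t within {0..}))"

definition entropy_const ::
  "('d::finite, 'm::finite) lq_problem \<Rightarrow> real \<Rightarrow> real \<Rightarrow> real" where
  "entropy_const P \<gamma> t =
     \<gamma> / 2 * (real CARD('m) * ln (pi * \<gamma>) - ln (det (ctrl_cost P t)))"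

end

theory Submission
  imports Defs "HOL-Probability.Distributions"
begin

text \<open>
  Completing the square, the Hamiltonian of a quadratic \<open>V\<close> is its value at the feedback control
  minus the positive definite form \<open>R\<close> of the deviation from it, which settles the unregularized
  case. With entropy, this is a constant plus \<open>\<gamma>\<close> times the log-density of the claimed Gaussian, and
  Gibbs' inequality shows that no other policy does better; the constant is a Gaussian integral.
  Either way the HJB equation says at each time that a quadratic polynomial in \<open>x\<close> with symmetric
  leading matrix vanishes identically, that is, that both its coefficients vanish.
\<close>

subsection \<open>Linear change of variables\<close>

text \<open>The normalizing constant rests on one algebraic fact: a positive definite
  \<open>R\<close> admits \<open>A\<close> with \<open>transpose A ** R ** A = mat 1\<close>.
  Gram-Schmidt supplies \<open>A\<close> without eigenvalues or square roots of matrices, and taking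
  determinants yields both the sign of \<open>det R\<close> and the Jacobian of the substitution
  that makes the Gaussian integral a product. In the entropy comparison the delicate point is
  integrability: the log-density of the Gaussian must be integrable against an arbitrary policy. It
  is quadratic in the control, so the finite second moment in \<open>policies\<close> is what makes
  it so. The covariance is forced: the optimal density is proportional to the exponential of the
  reward divided by \<gamma>, whose quadratic part is \<open>R\<close> divided by \<gamma>, that is,
  half of the precision matrix. A quadratic form sees only the symmetric part of its matrix.
  Comparing coefficients in \<open>x\<close> is therefore legitimate only once the derivative of
  \<open>H\<close> is known to be symmetric as well.\<close>

lemma nn_integral_lborel_shear:
  fixes f :: "real ^ 'n \<Rightarrow> ennreal"
  assumes [measurable]: "f \<in> borel_measurable borel" and mn: "m \<noteq> n"
  shows "(\<integral>\<^sup>+x. f (x + (c * x $ n) *\<^sub>R axis m 1) \<partial>lborel) = (\<integral>\<^sup>+x. f x \<partial>lborel)"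
proof -
  interpret product_sigma_finite "\<lambda>_::real ^ 'n. lborel :: real measure"
    by standard
  let ?e = "axis m 1 :: real ^ 'n"
  define I where "I = (Basis :: (real ^ 'n) set) - {?e}"
  have e: "?e \<in> Basis" and I: "finite I" "?e \<notin> I" "Basis = insert ?e I"
    by (auto simp: I_def axis_in_Basis_iff)
  \<comment> \<open>Coordinate \<open>m\<close> is integrated innermost, with all others
    frozen.\<close>
  have fubini: "(\<integral>\<^sup>+x. h x \<partial>lborel) =
      (\<integral>\<^sup>+x. (\<integral>\<^sup>+y. h (y *\<^sub>R ?e + (\<Sum>b\<in>I. x b *\<^sub>R b)) \<partial>lborel) \<partial>Pi\<^sub>M I (\<lambda>_. lborel))"
    if [measurable]: "h \<in> borel_measurable borel" for h :: "real ^ 'n \<Rightarrow> ennreal"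
  proof -
    have "(\<integral>\<^sup>+x. h x \<partial>lborel) =
        (\<integral>\<^sup>+x. h (\<Sum>b\<in>insert ?e I. x b *\<^sub>R b) \<partial>Pi\<^sub>M (insert ?e I) (\<lambda>_. lborel))"
      unfolding I(3)[symmetric] by (subst lborel_eq) (simp add: nn_integral_distr)
    also have "\<dots> = (\<integral>\<^sup>+x. (\<integral>\<^sup>+y. h (\<Sum>b\<in>insert ?e I. (x(?e := y)) b *\<^sub>R b) \<partial>lborel)
        \<partial>Pi\<^sub>M I (\<lambda>_. lborel))"
      by (rule product_nn_integral_insert) (use I in auto)
    also have "(\<lambda>x y. \<Sum>b\<in>insert ?e I. (x(?e := y)) b *\<^sub>R b) =
        (\<lambda>x y. y *\<^sub>R ?e + (\<Sum>b\<in>I. x b *\<^sub>R b))"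
      using I(1,2) by (auto simp: fun_eq_iff intro!: sum.cong)
    finally show ?thesis .
  qed
  \<comment> \<open>As \<open>m\<close> differs from \<open>n\<close>, coordinate \<open>n\<close>
    does not depend on \<open>y\<close>; on the innermost integral the shear is a translation by the
    constant \<open>c * s $ n\<close>.\<close>
  have shift: "(\<integral>\<^sup>+y. f (y *\<^sub>R ?e + s + (c * (y *\<^sub>R ?e + s) $ n) *\<^sub>R ?e) \<partial>lborel) =
      (\<integral>\<^sup>+y. f (y *\<^sub>R ?e + s) \<partial>lborel)" for s
  proof -
    have "(\<integral>\<^sup>+y. f (y *\<^sub>R ?e + s) \<partial>lborel) = (\<integral>\<^sup>+y. f ((c * s $ n + 1 * y) *\<^sub>R ?e + s) \<partial>lborel)"
      by (subst nn_integral_real_affine[where c = 1 and t = "c * s $ n"]) auto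
    also have "\<dots> = (\<integral>\<^sup>+y. f (y *\<^sub>R ?e + s + (c * (y *\<^sub>R ?e + s) $ n) *\<^sub>R ?e) \<partial>lborel)"
      using mn by (intro nn_integral_cong arg_cong[of _ _ f]) (simp add: axis_def algebra_simps)
    finally show ?thesis by simp
  qed
  have sheared: "(\<lambda>x. f (x + (c * x $ n) *\<^sub>R ?e)) \<in> borel_measurable borel"
  proof -
    have "(\<lambda>x. x + (c * x $ n) *\<^sub>R ?e) \<in> borel \<rightarrow>\<^sub>M borel"
      by (intro borel_measurable_continuous_onI continuous_intros)
    then show ?thesis by measurable
  qed
  show ?thesis
    by (simp only: fubini[OF sheared] fubini[OF assms(1)] shift)
qed

lemma borel_measurable_matrix_vector_mult [measurable]:
  fixes A :: "real ^ 'n ^ 'm"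
  shows "(\<lambda>x. A *v x) \<in> borel \<rightarrow>\<^sub>M borel"
  by (intro borel_measurable_continuous_onI linear_continuous_on matrix_vector_mul_bounded_linear)

text \<open>Lebesgue measure is determined by the volume of boxes. The preimage of a box is the box
  with permuted corners, and the product of the side lengths ignores their order.\<close>

lemma lborel_distr_swap:
  fixes m n :: "'n::finite"
  shows "distr lborel borel (\<lambda>x::real ^ 'n. \<chi> i. x $ Transposition.transpose m n i) = lborel"
    (is "distr _ _ ?T = _")
proof (rule lborel_eqI[symmetric])
  have [measurable]: "?T \<in> borel \<rightarrow>\<^sub>M borel"
    by (intro borel_measurable_continuous_onI continuous_intros)
  let ?\<sigma> = "Transposition.transpose m n"
  have bij: "bij ?\<sigma>" by simp
  fix l u :: "real ^ 'n" assume le: "\<And>b. b \<in> Basis \<Longrightarrow> l \<bullet> b \<le> u \<bullet> b"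
  then have le': "l $ i \<le> u $ i" for i
    using le[of "axis i 1"] by (simp add: axis_in_Basis_iff inner_axis)
  have "?T -` box l u = box (?T l) (?T u)"
  proof -
    have "(\<forall>i. l $ i < x $ ?\<sigma> i \<and> x $ ?\<sigma> i < u $ i) \<longleftrightarrow>
        (\<forall>i. l $ ?\<sigma> i < x $ i \<and> x $ i < u $ ?\<sigma> i)" for x :: "real ^ 'n"
      by (metis transpose_involutory)
    then show ?thesis by (auto simp: mem_box_cart)
  qed
  moreover have "(\<Prod>b\<in>Basis. (w::real ^ 'n) \<bullet> b) = (\<Prod>i\<in>UNIV. w $ i)" for w
    by (simp add: Basis_vec_def UNION_singleton_eq_range prod.reindex inner_axis axis_eq_axis inj_def)
  moreover have "(\<Prod>i\<in>UNIV. (u - l) $ ?\<sigma> i) = (\<Prod>i\<in>UNIV. (u - l) $ i)"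
    by (rule prod.reindex_bij_betw[OF bij])
  ultimately show "emeasure (distr lborel borel ?T) (box l u) = (\<Prod>b\<in>Basis. (u - l) \<bullet> b)"
    using le' by (simp add: emeasure_distr emeasure_lborel_box_eq Basis_vec_def inner_axis)
qed simp

text \<open>The change-of-variables theorems of the library require a well-ordered index type.\<close>

proposition nn_integral_lborel_linear:
  fixes A :: "real ^ 'n ^ 'n"
  assumes "f \<in> borel_measurable borel" and "det A \<noteq> 0"
  shows "(\<integral>\<^sup>+x. f x \<partial>lborel) = ennreal \<bar>det A\<bar> * (\<integral>\<^sup>+x. f (A *v x) \<partial>lborel)"
proof -
  \<comment> \<open>The integrand is quantified inside the predicate because the product step
    applies the hypothesis for \<open>B\<close> to the integrand composed with \<open>A\<close>. The
    guard on the determinant makes the zero-row case vacuous.\<close>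
  let ?P = "\<lambda>A :: real ^ 'n ^ 'n. det A \<noteq> 0 \<longrightarrow> (\<forall>f \<in> borel_measurable borel.
    (\<integral>\<^sup>+x. f x \<partial>lborel) = ennreal \<bar>det A\<bar> * (\<integral>\<^sup>+x. f (A *v x) \<partial>lborel))"
  have "?P A"
  proof (rule induct_matrix_elementary[where P = ?P])
    fix A B :: "real ^ 'n ^ 'n"
    assume AB: "?P A" "?P B"
    show "?P (A ** B)"
    proof (intro impI ballI)
      fix f :: "real ^ 'n \<Rightarrow> ennreal"
      assume nz: "det (A ** B) \<noteq> 0" and f [measurable]: "f \<in> borel_measurable borel"
      from nz have nz': "det A \<noteq> 0" "det B \<noteq> 0" by (auto simp: det_mul)
      have "(\<integral>\<^sup>+x. f x \<partial>lborel) = ennreal \<bar>det A\<bar> * (\<integral>\<^sup>+x. f (A *v x) \<partial>lborel)"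
        using AB(1) nz'(1) f by blast
      also have "(\<integral>\<^sup>+x. f (A *v x) \<partial>lborel) = ennreal \<bar>det B\<bar> * (\<integral>\<^sup>+x. f (A *v (B *v x)) \<partial>lborel)"
      proof -
        have "(\<lambda>x. f (A *v x)) \<in> borel_measurable borel" by measurable
        with AB(2) nz'(2) show ?thesis by blast
      qed
      finally show "(\<integral>\<^sup>+x. f x \<partial>lborel) =
          ennreal \<bar>det (A ** B)\<bar> * (\<integral>\<^sup>+x. f (A ** B *v x) \<partial>lborel)"
        by (simp add: det_mul abs_mult ennreal_mult' mult.assoc matrix_vector_mul_assoc)
    qed
  next
    fix A :: "real ^ 'n ^ 'n" and i
    assume "row i A = 0"
    then show "?P A" by (simp add: det_zero_row)
  next
    fix A :: "real ^ 'n ^ 'n"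
    assume diagonal: "\<And>i j. i \<noteq> j \<Longrightarrow> A $ i $ j = 0"
    show "?P A"
    proof (intro impI ballI)
      fix f :: "real ^ 'n \<Rightarrow> ennreal"
      assume nz: "det A \<noteq> 0" and [measurable]: "f \<in> borel_measurable borel"
      have det: "det A = (\<Prod>i\<in>UNIV. A $ i $ i)"
        using diagonal by (rule det_diagonal)
      \<comment> \<open>The diagonal entries, indexed by basis vectors to fit
        \<open>lborel_affine_euclidean\<close>.\<close>
      define c where "c = (\<lambda>b :: real ^ 'n. b \<bullet> (A *v b))"
      have c: "c (axis i 1) = A $ i $ i" for i
        by (simp add: c_def inner_axis' matrix_vector_mult_basis column_def)
      have "(\<Sum>b\<in>Basis. (c b * (x \<bullet> b)) *\<^sub>R b) = A *v x" for x
      proof -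
        have "(\<Sum>b\<in>Basis. (c b * (x \<bullet> b)) *\<^sub>R b) = (\<Sum>i\<in>UNIV. (A $ i $ i * x $ i) *\<^sub>R axis i 1)"
          by (simp add: Basis_vec_def UNION_singleton_eq_range sum.reindex inj_def axis_eq_axis c inner_axis)
        also have "\<dots> = A *v x"
        proof (subst vec_eq_iff, intro allI)
          fix j
          have "(A *v x) $ j = (\<Sum>k\<in>UNIV. if k = j then A $ j $ j * x $ j else 0)"
            unfolding matrix_vector_mult_def vec_lambda_beta
            by (intro sum.cong refl) (metis diagonal mult_zero_left)
          also have "\<dots> = A $ j $ j * x $ j" by simp
          finally have "(A *v x) $ j = A $ j $ j * x $ j" .
          then show "(\<Sum>i\<in>UNIV. (A $ i $ i * x $ i) *\<^sub>R axis i 1) $ j = (A *v x) $ j"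
            by (simp only: sum_component vector_scaleR_component axis_def) (simp add: if_distrib cong: if_cong)
        qed
        finally show ?thesis .
      qed
      moreover have "(\<Prod>b\<in>Basis. \<bar>c b\<bar>) = \<bar>det A\<bar>"
        by (simp add: Basis_vec_def UNION_singleton_eq_range prod.reindex inj_def axis_eq_axis c det abs_prod)
      moreover have "c b \<noteq> 0" if "b \<in> Basis" for b
        using that nz by (auto simp: Basis_vec_def c det)
      ultimately have "(lborel :: (real ^ 'n) measure) = density (distr lborel borel ((*v) A)) (\<lambda>_. \<bar>det A\<bar>)"
        using lborel_affine_euclidean[of c 0] by simp
      then have "(\<integral>\<^sup>+x. f x \<partial>lborel) = (\<integral>\<^sup>+x. f x \<partial>density (distr lborel borel ((*v) A)) (\<lambda>_. \<bar>det A\<bar>))"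
        by simp
      also have "\<dots> = ennreal \<bar>det A\<bar> * (\<integral>\<^sup>+x. f (A *v x) \<partial>lborel)"
        by (simp add: nn_integral_density nn_integral_distr nn_integral_cmult)
      finally show "(\<integral>\<^sup>+x. f x \<partial>lborel) = ennreal \<bar>det A\<bar> * (\<integral>\<^sup>+x. f (A *v x) \<partial>lborel)" .
    qed
  next
    fix m n :: 'n
    let ?\<sigma> = "Transposition.transpose m n"
    let ?A = "\<chi> i j. (mat 1 :: real ^ 'n ^ 'n) $ i $ ?\<sigma> j"
    have "det ?A = of_int (sign ?\<sigma>) * det (mat 1 :: real ^ 'n ^ 'n)"
      by (rule det_permute_columns) (simp add: permutes_swap_id)
    then have det: "\<bar>det ?A\<bar> = 1"
      by (simp flip: of_int_abs)
    have mult: "?A *v x = (\<chi> i. x $ ?\<sigma> i)" for x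
    proof -
      have "(?A *v x) $ i = (\<Sum>j\<in>UNIV. if j = ?\<sigma> i then x $ j else 0)" for i
        unfolding matrix_vector_mult_def mat_def vec_lambda_beta
        by (intro sum.cong refl) (metis mult_1 mult_zero_left transpose_involutory)
      then show ?thesis by (simp add: vec_eq_iff)
    qed
    show "?P ?A"
    proof (intro impI ballI)
      fix f :: "real ^ 'n \<Rightarrow> ennreal"
      assume [measurable]: "f \<in> borel_measurable borel"
      have [measurable]: "(\<lambda>x::real ^ 'n. \<chi> i. x $ ?\<sigma> i) \<in> borel \<rightarrow>\<^sub>M borel"
        by (intro borel_measurable_continuous_onI continuous_intros)
      have "(\<integral>\<^sup>+x. f x \<partial>lborel) = (\<integral>\<^sup>+x. f (\<chi> i. x $ ?\<sigma> i) \<partial>lborel)"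
        by (subst lborel_distr_swap[of m n, symmetric]) (simp add: nn_integral_distr)
      then show "(\<integral>\<^sup>+x. f x \<partial>lborel) = ennreal \<bar>det ?A\<bar> * (\<integral>\<^sup>+x. f (?A *v x) \<partial>lborel)"
        unfolding det mult by simp
    qed
  next
    fix m n :: 'n and c :: real
    assume mn: "m \<noteq> n"
    let ?A = "(\<chi> i j. if i = m \<and> j = n then c else of_bool (i = j)) :: real ^ 'n ^ 'n"
    have "?A = (\<chi> k. if k = m then row m (mat 1) + c *s row n (mat 1) else row k (mat 1))"
      using mn by (auto simp: vec_eq_iff row_def mat_def)
    then have det: "det ?A = 1"
      using det_row_operation[OF mn, of "mat 1" c] by simp
    have mult: "?A *v x = x + (c * x $ n) *\<^sub>R axis m 1" for x
    proof -
      have "(?A *v x) $ i = (\<Sum>j\<in>UNIV. (if j = i then x $ i else 0) + (if j = n then if i = m then c * x $ n else 0 else 0))" for i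
        unfolding matrix_vector_mult_def using mn
        by (auto intro!: sum.cong)
      then show ?thesis
        by (simp add: vec_eq_iff sum.distrib axis_def)
    qed
    show "?P ?A"
      unfolding det mult using mn by (simp add: nn_integral_lborel_shear)
  qed
  then show ?thesis using assms by blast
qed

subsection \<open>Positive definite matrices\<close>

lemma inner_transpose_mult:
  fixes A :: "real ^ 'n ^ 'm"
  shows "x \<bullet> (transpose A *v y) = (A *v x) \<bullet> y"
  by (metis dot_lmul_matrix inner_commute transpose_matrix_vector)

lemma inner_sym_mat:
  fixes S :: "real ^ 'n ^ 'n"
  assumes "sym_mat S"
  shows "x \<bullet> (S *v y) = y \<bullet> (S *v x)"
  using inner_transpose_mult[of x S y] assms by (simp add: sym_mat_def inner_commute del: transpose_matrix_vector)

lemma matrix_inv: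
  fixes A :: "real ^ 'n ^ 'n"
  assumes "det A \<noteq> 0"
  shows "A ** matrix_inv A = mat 1" and "matrix_inv A ** A = mat 1"
proof -
  have "\<exists>B. A ** B = mat 1 \<and> B ** A = mat 1"
    using assms by (simp add: invertible_det_nz flip: invertible_def)
  then have "A ** matrix_inv A = mat 1 \<and> matrix_inv A ** A = mat 1"
    unfolding matrix_inv_def by (rule someI_ex)
  then show "A ** matrix_inv A = mat 1" and "matrix_inv A ** A = mat 1"
    by auto
qed

lemma matrix_inv_unique:
  fixes A B :: "real ^ 'n ^ 'n"
  assumes "A ** B = mat 1"
  shows "matrix_inv A = B"
proof -
  have "det A * det B = 1"
    using assms by (metis det_I det_mul)
  then have "det A \<noteq> 0" by auto
  then show ?thesis
    by (metis assms matrix_inv(2) matrix_mul_assoc matrix_mul_lid matrix_mul_rid)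
qed

text \<open>Gram-Schmidt for the inner product \<open>x \<bullet> (R *v y)\<close>. As long as fewer
  than \<open>CARD('n)\<close> vectors are present, their span is proper, so a vector outside it can
  be projected and normalized.\<close>

lemma pos_def_orthonormal_family:
  fixes R :: "real ^ 'n ^ 'n"
  assumes R: "pos_def R"
  shows "k \<le> CARD('n) \<Longrightarrow> \<exists>B. finite B \<and> card B = k \<and>
    (\<forall>b\<in>B. \<forall>c\<in>B. b \<bullet> (R *v c) = (if b = c then 1 else 0))"
proof (induction k)
  case 0
  show ?case by (intro exI[of _ "{}"]) auto
next
  case (Suc k)
  then obtain B where B: "finite B" "card B = k"
    and orth: "\<And>b c. b \<in> B \<Longrightarrow> c \<in> B \<Longrightarrow> b \<bullet> (R *v c) = (if b = c then 1 else 0)"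
    by auto
  have sym: "x \<bullet> (R *v y) = y \<bullet> (R *v x)" for x y
    using R by (intro inner_sym_mat) (simp add: pos_def_def)
  have "dim (span B) < CARD('n)"
    using dim_le_card'[OF B(1)] B(2) Suc.prems by simp
  then have "span B \<noteq> UNIV"
    by (metis dim_UNIV DIM_cart DIM_real mult.right_neutral nat_neq_iff)
  then obtain v where v: "v \<notin> span B" by auto
  define w where "w = v - (\<Sum>b\<in>B. (b \<bullet> (R *v v)) *\<^sub>R b)"
  have "(\<Sum>b\<in>B. (b \<bullet> (R *v v)) *\<^sub>R b) \<in> span B"
    by (intro span_sum span_scale span_base)
  then have "w \<noteq> 0" using v by (auto simp: w_def)
  then have pos: "0 < w \<bullet> (R *v w)"
    using R by (simp add: pos_def_def)
  have perp: "b \<bullet> (R *v w) = 0" if "b \<in> B" for b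
  proof -
    have "b \<bullet> (R *v w) = b \<bullet> (R *v v) - (\<Sum>c\<in>B. (c \<bullet> (R *v v)) * (b \<bullet> (R *v c)))"
      by (simp add: w_def matrix_vector_mult_diff_distrib inner_diff_right inner_sum_right
          linear_sum[OF matrix_vector_mul_linear] matrix_vector_mult_scaleR)
    also have "(\<Sum>c\<in>B. (c \<bullet> (R *v v)) * (b \<bullet> (R *v c))) = (\<Sum>c\<in>B. if c = b then b \<bullet> (R *v v) else 0)"
      using that orth by (intro sum.cong) auto
    finally show ?thesis using that B(1) by simp
  qed
  define e where "e = (1 / sqrt (w \<bullet> (R *v w))) *\<^sub>R w"
  have e1: "e \<bullet> (R *v e) = 1"
    using pos by (simp add: e_def matrix_vector_mult_scaleR)
  have e0: "b \<bullet> (R *v e) = 0" if "b \<in> B" for b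
    using perp[OF that] by (simp add: e_def matrix_vector_mult_scaleR)
  have "e \<notin> B" using e0 e1 by fastforce
  moreover have "e \<bullet> (R *v b) = 0" if "b \<in> B" for b
    using e0[OF that] sym[of e b] by simp
  ultimately show ?case
    using B orth e0 e1 by (intro exI[of _ "insert e B"]) auto
qed

text \<open>The columns of \<open>A\<close> form an \<open>R\<close>-orthonormal basis. This
  \<open>A\<close> plays the role of a square root of the inverse of \<open>R\<close>.\<close>

lemma pos_def_congruent_mat_1:
  fixes R :: "real ^ 'n ^ 'n"
  assumes "pos_def R"
  obtains A :: "real ^ 'n ^ 'n" where "transpose A ** R ** A = mat 1"
proof -
  obtain B where B: "finite B" "card B = CARD('n)"
    and orth: "\<forall>b\<in>B. \<forall>c\<in>B. b \<bullet> (R *v c) = (if b = c then 1 else 0)"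
    using pos_def_orthonormal_family[OF assms order.refl] by blast
  then obtain f :: "'n \<Rightarrow> real ^ 'n" where f: "bij_betw f UNIV B"
    by (metis finite_same_card_bij finite_class.finite_UNIV)
  define A :: "real ^ 'n ^ 'n" where "A = (\<chi> i j. f j $ i)"
  have col: "A *v axis j 1 = f j" for j
    by (simp add: matrix_vector_mult_basis column_def A_def vec_eq_iff)
  have entry: "M $ i $ j = axis i 1 \<bullet> (M *v axis j 1)" for M :: "real ^ 'n ^ 'n" and i j
    by (simp add: inner_axis' matrix_vector_mult_basis column_def)
  have "(transpose A ** R ** A) $ i $ j = mat 1 $ i $ j" for i j
  proof -
    have "(transpose A ** R ** A) $ i $ j = f i \<bullet> (R *v f j)"
      by (simp add: entry inner_transpose_mult col del: transpose_matrix_vector flip: matrix_vector_mul_assoc)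
    also have "\<dots> = (if f i = f j then 1 else 0)"
      using f orth by (auto simp: bij_betw_def)
    also have "\<dots> = mat 1 $ i $ j"
      using f by (auto simp: mat_def bij_betw_def inj_def)
    finally show ?thesis .
  qed
  then show thesis
    by (intro that[of A]) (simp add: vec_eq_iff)
qed

lemma pos_def_det_pos:
  fixes R :: "real ^ 'n ^ 'n"
  assumes "pos_def R"
  shows "0 < det R"
proof -
  obtain A :: "real ^ 'n ^ 'n" where "transpose A ** R ** A = mat 1"
    using pos_def_congruent_mat_1[OF assms] .
  then have "det (transpose A ** R ** A) = 1" by simp
  then have "(det A)\<^sup>2 * det R = 1"
    by (simp add: det_mul power2_eq_square mult_ac)
  then show ?thesis
    by (metis not_one_le_zero zero_le_power2 mult_nonneg_nonpos not_le)
qed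

text \<open>In the coordinates \<open>v = A *v y\<close> the form is the squared norm of
  \<open>y\<close>, so the squared operator norm of \<open>A\<close> serves as \<open>K\<close>.
  This is what controls second moments of Gaussians.\<close>

lemma pos_def_coercive:
  fixes R :: "real ^ 'n ^ 'n"
  assumes "pos_def R"
  obtains K where "0 \<le> K" and "\<And>v. (norm v)\<^sup>2 \<le> K * (v \<bullet> (R *v v))"
proof -
  obtain A :: "real ^ 'n ^ 'n" where A: "transpose A ** R ** A = mat 1"
    using pos_def_congruent_mat_1[OF assms] .
  then have "det (transpose A ** R ** A) = 1" by simp
  then have "det A \<noteq> 0" by (auto simp: det_mul)
  have "(norm v)\<^sup>2 \<le> (onorm ((*v) A))\<^sup>2 * (v \<bullet> (R *v v))" for v
  proof -
    define y where "y = matrix_inv A *v v"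
    have v: "v = A *v y"
      using matrix_inv(1)[OF \<open>det A \<noteq> 0\<close>] by (simp add: y_def matrix_vector_mul_assoc)
    have "v \<bullet> (R *v v) = y \<bullet> ((transpose A ** R ** A) *v y)"
      unfolding v by (simp add: inner_transpose_mult del: transpose_matrix_vector flip: matrix_vector_mul_assoc)
    also have "\<dots> = (norm y)\<^sup>2"
      by (simp add: A power2_norm_eq_inner)
    finally show ?thesis
      unfolding v by (simp add: onorm power_mult_distrib[symmetric] power_mono)
  qed
  then show thesis by (intro that[of "(onorm ((*v) A))\<^sup>2"]) auto
qed

lemma det_scaleR:
  fixes A :: "real ^ 'n ^ 'n"
  shows "det (k *\<^sub>R A) = k ^ CARD('n) * det A"
  by (simp add: det_def prod.distrib sum_distrib_left mult_ac)

lemma scaleR_matrix_mult_vector: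
  fixes A :: "real ^ 'n ^ 'm"
  shows "(k *\<^sub>R A) *v x = k *\<^sub>R (A *v x)"
  by (simp add: scaleR_matrix_vector_assoc)

lemma pos_def_scaleR:
  assumes "pos_def A" and "0 < k"
  shows "pos_def (k *\<^sub>R A)"
  using assms by (auto simp: pos_def_def sym_mat_def transpose_scalar scaleR_matrix_mult_vector)

lemma pos_def_matrix_inv:
  fixes A :: "real ^ 'n ^ 'n"
  assumes A: "pos_def A"
  shows "pos_def (matrix_inv A)"
proof -
  have "det A \<noteq> 0" using pos_def_det_pos[OF A] by simp
  note inv = matrix_inv[OF this]
  have "transpose A = A" using A by (simp add: pos_def_def sym_mat_def)
  \<comment> \<open>The transpose of \<open>inv(2)\<close>. A right inverse of a square matrix is
    its inverse, hence the symmetry.\<close>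
  then have "A ** transpose (matrix_inv A) = mat 1"
    by (metis inv(2) matrix_transpose_mul transpose_mat)
  then have sym: "transpose (matrix_inv A) = matrix_inv A"
    using matrix_inv_unique by metis
  have "0 < v \<bullet> (matrix_inv A *v v)" if "v \<noteq> 0" for v
  proof -
    define w where "w = matrix_inv A *v v"
    have v: "v = A *v w" by (simp add: w_def matrix_vector_mul_assoc inv)
    with that have "w \<noteq> 0" by auto
    then have "0 < w \<bullet> (A *v w)" using A by (simp add: pos_def_def)
    then show ?thesis by (simp add: v[symmetric] inner_commute flip: w_def)
  qed
  with sym show ?thesis by (simp add: pos_def_def sym_mat_def)
qed

subsection \<open>Gaussian policies\<close>

text \<open>Translating by \<mu> and substituting \<open>u = A *v y\<close> with the congruence
  matrix \<open>A\<close> leaves a product of one-dimensional Gaussians; the Jacobian is the inverse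
  square root of \<open>det R\<close>.\<close>

lemma has_bochner_integral_exp_neg_quadratic:
  fixes R :: "real ^ 'n ^ 'n"
  assumes R: "pos_def R"
  shows "has_bochner_integral lborel (\<lambda>u. exp (- ((u - \<mu>) \<bullet> (R *v (u - \<mu>)))))
    (sqrt (pi ^ CARD('n) / det R))"
proof (rule has_bochner_integral_nn_integral)
  have cont: "continuous_on UNIV (\<lambda>u. exp (- ((u - \<nu>) \<bullet> (R *v (u - \<nu>)))))" for \<nu> :: "real ^ 'n"
    by (intro continuous_intros bounded_linear.continuous_on[OF matrix_vector_mul_bounded_linear])
  then show "(\<lambda>u. exp (- ((u - \<mu>) \<bullet> (R *v (u - \<mu>))))) \<in> borel_measurable lborel"
    by (simp add: borel_measurable_continuous_onI)
  show "0 \<le> sqrt (pi ^ CARD('n) / det R)"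
    using pos_def_det_pos[OF R] by simp
  obtain A :: "real ^ 'n ^ 'n" where A: "transpose A ** R ** A = mat 1"
    using pos_def_congruent_mat_1[OF R] .
  then have "det (transpose A ** R ** A) = 1" by simp
  then have detA: "(det A)\<^sup>2 * det R = 1"
    by (simp add: det_mul power2_eq_square mult_ac)
  then have "det A \<noteq> 0" by auto
  have "\<bar>det A\<bar> = sqrt (1 / det R)"
    using detA by (metis nonzero_eq_divide_eq mult_zero_right real_sqrt_abs zero_neq_one)
  then have val: "\<bar>det A\<bar> * sqrt pi ^ CARD('n) = sqrt (pi ^ CARD('n) / det R)"
    by (simp add: real_sqrt_mult[symmetric] real_sqrt_power[symmetric] flip: real_sqrt_divide)
  \<comment> \<open>\<open>gaussian_moment_0\<close> covers the half-line; evenness doubles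
    it.\<close>
  have gauss: "(\<integral>\<^sup>+x. ennreal (exp (- x\<^sup>2)) \<partial>lborel) = ennreal (sqrt pi)"
    using has_bochner_integral_even_function[OF gaussian_moment_0]
    by (subst nn_integral_eq_integral) (auto simp: has_bochner_integral_iff)
  have quad: "(A *v y) \<bullet> (R *v (A *v y)) = y \<bullet> y" for y
  proof -
    have "(A *v y) \<bullet> (R *v (A *v y)) = y \<bullet> ((transpose A ** R ** A) *v y)"
      by (simp add: inner_transpose_mult del: transpose_matrix_vector flip: matrix_vector_mul_assoc)
    then show ?thesis by (simp add: A)
  qed
  have "(\<integral>\<^sup>+u. ennreal (exp (- ((u - \<mu>) \<bullet> (R *v (u - \<mu>))))) \<partial>lborel) =
      (\<integral>\<^sup>+u. ennreal (exp (- (u \<bullet> (R *v u)))) \<partial>lborel)"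
    using cont[of \<mu>]
    by (subst lborel_distr_plus[of \<mu>, symmetric], subst nn_integral_distr)
       (auto intro: measurable_compose[OF borel_measurable_continuous_onI])
  also have "\<dots> = ennreal \<bar>det A\<bar> * (\<integral>\<^sup>+(y :: real ^ 'n). ennreal (exp (- (y \<bullet> y))) \<partial>lborel)"
    using cont[of 0] \<open>det A \<noteq> 0\<close>
    by (subst nn_integral_lborel_linear[of _ A])
       (auto simp: quad intro: measurable_compose[OF borel_measurable_continuous_onI])
  also have "(\<lambda>y :: real ^ 'n. ennreal (exp (- (y \<bullet> y)))) = (\<lambda>y. \<Prod>b\<in>Basis. ennreal (exp (- (y \<bullet> b)\<^sup>2)))"
    by (simp add: fun_eq_iff prod_ennreal exp_sum[symmetric] sum_negf power2_eq_square
        flip: euclidean_inner)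
  also have "(\<integral>\<^sup>+(y :: real ^ 'n). (\<Prod>b\<in>Basis. ennreal (exp (- (y \<bullet> b)\<^sup>2))) \<partial>lborel) =
      (\<Prod>b\<in>(Basis :: (real ^ 'n) set). ennreal (sqrt pi))"
    by (subst nn_integral_lborel_prod) (auto simp: gauss)
  also have "ennreal \<bar>det A\<bar> * \<dots> = ennreal (\<bar>det A\<bar> * sqrt pi ^ CARD('n))"
    by (simp add: ennreal_mult ennreal_power)
  finally show "(\<integral>\<^sup>+u. ennreal (exp (- ((u - \<mu>) \<bullet> (R *v (u - \<mu>))))) \<partial>lborel) =
      ennreal (sqrt (pi ^ CARD('n) / det R))"
    by (simp add: val)
qed simp

section \<open>Quadratic growth and second moments\<close>

lemma norm_diff_power2_le:
  fixes x y :: "'a::real_inner"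
  shows "(norm (x - y))\<^sup>2 \<le> 2 * (norm x)\<^sup>2 + 2 * (norm y)\<^sup>2"
proof -
  have "(norm (x - y))\<^sup>2 + (norm (x + y))\<^sup>2 = 2 * (norm x)\<^sup>2 + 2 * (norm y)\<^sup>2"
    by (simp add: power2_norm_eq_inner algebra_simps)
  then show ?thesis by (smt (verit) zero_le_power2)
qed

lemma quadratic_form_growth:
  fixes A :: "real ^ 'n ^ 'n"
  obtains C where "\<And>u. \<bar>(u - \<mu>) \<bullet> (A *v (u - \<mu>))\<bar> \<le> C * (1 + (norm u)\<^sup>2)"
proof -
  define K where "K = onorm ((*v) A)"
  have "0 \<le> K" by (simp add: K_def onorm_pos_le)
  have "\<bar>(u - \<mu>) \<bullet> (A *v (u - \<mu>))\<bar> \<le> (2 * K * (1 + (norm \<mu>)\<^sup>2)) * (1 + (norm u)\<^sup>2)" for u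
  proof -
    have "\<bar>(u - \<mu>) \<bullet> (A *v (u - \<mu>))\<bar> \<le> norm (u - \<mu>) * norm (A *v (u - \<mu>))"
      by (rule Cauchy_Schwarz_ineq2)
    also have "\<dots> \<le> norm (u - \<mu>) * (K * norm (u - \<mu>))"
      by (intro mult_left_mono) (auto simp: K_def onorm)
    also have "\<dots> = K * (norm (u - \<mu>))\<^sup>2" by (simp add: power2_eq_square)
    also have "\<dots> \<le> K * (2 * (norm u)\<^sup>2 + 2 * (norm \<mu>)\<^sup>2)"
      using \<open>0 \<le> K\<close> by (intro mult_left_mono norm_diff_power2_le)
    \<comment> \<open>A sum of the two squared norms is at most the product of one plus each, which
      separates \<mu> from \<open>u\<close>.\<close>
    also have "\<dots> \<le> K * (2 * (1 + (norm \<mu>)\<^sup>2) * (1 + (norm u)\<^sup>2))"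
      using \<open>0 \<le> K\<close> by (intro mult_left_mono) (auto simp: algebra_simps)
    finally show ?thesis by (simp add: mult_ac)
  qed
  then show thesis by (rule that)
qed

lemma integrable_mult_quadratic_growth:
  fixes p h :: "real ^ 'n \<Rightarrow> real"
  assumes "\<And>u. 0 \<le> p u" and p: "integrable lborel p"
    and p2: "integrable lborel (\<lambda>u. (norm u)\<^sup>2 * p u)"
    and [measurable]: "h \<in> borel_measurable borel"
    and h: "\<And>u. \<bar>h u\<bar> \<le> C * (1 + (norm u)\<^sup>2)"
  shows "integrable lborel (\<lambda>u. h u * p u)"
proof (rule Bochner_Integration.integrable_bound)
  show "integrable lborel (\<lambda>u. C * (p u + (norm u)\<^sup>2 * p u))"
    using p p2 by simp
  show "(\<lambda>u. h u * p u) \<in> borel_measurable lborel"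
    using borel_measurable_integrable[OF p] by measurable
  show "AE u in lborel. norm (h u * p u) \<le> norm (C * (p u + (norm u)\<^sup>2 * p u))"
  proof (rule AE_I2)
    fix u
    have "\<bar>h u\<bar> * p u \<le> (C * (1 + (norm u)\<^sup>2)) * p u"
      using h assms(1) by (intro mult_right_mono)
    then show "norm (h u * p u) \<le> norm (C * (p u + (norm u)\<^sup>2 * p u))"
      using assms(1)[of u] by (simp add: abs_mult algebra_simps)
  qed
qed

lemma borel_measurable_quadratic_form [measurable]:
  fixes A :: "real ^ 'n ^ 'n"
  shows "(\<lambda>u. (u - \<mu>) \<bullet> (A *v (u - \<mu>))) \<in> borel_measurable borel"
  by (intro borel_measurable_continuous_onI continuous_intros
      bounded_linear.continuous_on[OF matrix_vector_mul_bounded_linear])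

text \<open>Half of the exponent absorbs the polynomial factor: with \<open>q\<close> the quadratic
  form, \<open>q * exp (- q) \<le> 2 * exp (- q / 2)\<close>, and the right side is integrable
  because half of \<open>R\<close> is again positive definite.\<close>

lemma integrable_norm2_exp_neg_quadratic:
  fixes R :: "real ^ 'n ^ 'n"
  assumes R: "pos_def R"
  shows "integrable lborel (\<lambda>u. (norm u)\<^sup>2 * exp (- ((u - \<mu>) \<bullet> (R *v (u - \<mu>)))))"
proof -
  let ?q = "\<lambda>u. (u - \<mu>) \<bullet> (R *v (u - \<mu>))"
  obtain K where K: "0 \<le> K" "\<And>v. (norm v)\<^sup>2 \<le> K * (v \<bullet> (R *v v))"
    using pos_def_coercive[OF R] by blast
  have int: "integrable lborel (\<lambda>u. exp (- (k * ?q u)))" if "0 < k" for k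
    using has_bochner_integral_exp_neg_quadratic[OF pos_def_scaleR[OF R that], of \<mu>]
    by (simp add: scaleR_matrix_mult_vector has_bochner_integral_iff)
  show ?thesis
  proof (rule Bochner_Integration.integrable_bound)
    \<comment> \<open>The 4 is the 2 of \<open>norm_diff_power2_le\<close> times the 2 of the
      exponential bound; the factors \<open>1 / 2\<close> and \<open>1\<close> put both terms in the
      shape of \<open>int\<close>.\<close>
    show "integrable lborel (\<lambda>u. 4 * K * exp (- (1 / 2 * ?q u)) + 2 * (norm \<mu>)\<^sup>2 * exp (- (1 * ?q u)))"
      by (intro Bochner_Integration.integrable_add integrable_mult_right int) auto
    show "AE u in lborel. norm ((norm u)\<^sup>2 * exp (- ?q u)) \<le>
        norm (4 * K * exp (- (1 / 2 * ?q u)) + 2 * (norm \<mu>)\<^sup>2 * exp (- (1 * ?q u)))"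
    proof (rule AE_I2)
      fix u
      have "(norm u)\<^sup>2 = (norm ((u - \<mu>) - (- \<mu>)))\<^sup>2" by simp
      also have "\<dots> \<le> 2 * (norm (u - \<mu>))\<^sup>2 + 2 * (norm (- \<mu>))\<^sup>2"
        by (rule norm_diff_power2_le)
      also have "\<dots> \<le> 2 * (K * ?q u) + 2 * (norm \<mu>)\<^sup>2"
        using K(2)[of "u - \<mu>"] by simp
      finally have "(norm u)\<^sup>2 * exp (- ?q u) \<le> (2 * (K * ?q u) + 2 * (norm \<mu>)\<^sup>2) * exp (- ?q u)"
        by (intro mult_right_mono) auto
      moreover have "?q u * exp (- ?q u) \<le> 2 * exp (- (1 / 2 * ?q u))"
      proof -
        have "?q u / 2 \<le> exp (?q u / 2)"
          using exp_ge_add_one_self[of "?q u / 2"] by linarith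
        then have "?q u * exp (- ?q u) \<le> (2 * exp (?q u / 2)) * exp (- ?q u)"
          by (intro mult_right_mono) auto
        also have "\<dots> = 2 * exp (- (1 / 2 * ?q u))"
          by (simp add: mult.assoc flip: exp_add)
        finally show ?thesis .
      qed
      then have "2 * K * (?q u * exp (- ?q u)) \<le> 2 * K * (2 * exp (- (1 / 2 * ?q u)))"
        using K(1) by (intro mult_left_mono) auto
      ultimately show "norm ((norm u)\<^sup>2 * exp (- ?q u)) \<le>
          norm (4 * K * exp (- (1 / 2 * ?q u)) + 2 * (norm \<mu>)\<^sup>2 * exp (- (1 * ?q u)))"
        using K(1) by (simp add: algebra_simps)
    qed
  qed measurable
qed

lemma gaussian_density_pos:
  assumes "pos_def S"
  shows "0 < gaussian_density \<mu> S u"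
  using pos_def_det_pos[OF assms] by (simp add: gaussian_density_def)

lemma ln_gaussian_density:
  fixes S :: "real ^ 'n ^ 'n"
  assumes "pos_def S"
  shows "ln (gaussian_density \<mu> S u) =
    - (1 / 2) * ((u - \<mu>) \<bullet> (matrix_inv S *v (u - \<mu>))) - (CARD('n) * ln (2 * pi) + ln (det S)) / 2"
  using pos_def_det_pos[OF assms]
  by (simp add: gaussian_density_def ln_div ln_sqrt ln_mult ln_realpow algebra_simps)

lemma gaussian_density_in_policies:
  fixes S :: "real ^ 'n ^ 'n"
  assumes S: "pos_def S"
  shows "gaussian_density \<mu> S \<in> policies"
proof -
  \<comment> \<open>Moves the \<open>1 / 2\<close> of the exponent into the matrix, so that the
    Gaussian integral applies; \<open>Z\<close> is then its value.\<close>
  define R where "R = (1 / 2) *\<^sub>R matrix_inv S"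
  define Z where "Z = sqrt ((2 * pi) ^ CARD('n) * det S)"
  have detS: "0 < det S" using pos_def_det_pos[OF S] .
  then have "0 < Z" by (simp add: Z_def)
  have R: "pos_def R"
    unfolding R_def by (intro pos_def_scaleR pos_def_matrix_inv S) simp
  have "det S * det (matrix_inv S) = 1"
    using matrix_inv(1)[of S] detS by (simp flip: det_mul)
  then have "det (matrix_inv S) = 1 / det S"
    using detS by (simp add: field_simps)
  then have Z: "sqrt (pi ^ CARD('n) / det R) = Z"
    by (simp add: R_def Z_def det_scaleR power_mult_distrib power_one_over field_simps)
  have density: "gaussian_density \<mu> S = (\<lambda>u. exp (- ((u - \<mu>) \<bullet> (R *v (u - \<mu>)))) / Z)"
    by (simp add: gaussian_density_def fun_eq_iff R_def Z_def scaleR_matrix_mult_vector)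
  have total: "has_bochner_integral lborel (gaussian_density \<mu> S) 1"
    using has_bochner_integral_divide_zero[OF has_bochner_integral_exp_neg_quadratic[OF R], of \<mu> Z] \<open>0 < Z\<close>
    by (simp add: density Z)
  have second: "integrable lborel (\<lambda>u. (norm u)\<^sup>2 * gaussian_density \<mu> S u)"
    using integrable_divide_zero[of Z, OF integrable_norm2_exp_neg_quadratic[OF R]]
    by (simp add: density)
  \<comment> \<open>The log-density is a quadratic form plus a constant, so the entropy integrand is
    dominated through the second moment.\<close>
  obtain C where C: "\<And>u. \<bar>(u - \<mu>) \<bullet> (matrix_inv S *v (u - \<mu>))\<bar> \<le> C * (1 + (norm u)\<^sup>2)"
    using quadratic_form_growth by blast
  have pos: "0 < gaussian_density \<mu> S u" for u
    using S by (rule gaussian_density_pos)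
  have "integrable lborel (\<lambda>u. ((u - \<mu>) \<bullet> (matrix_inv S *v (u - \<mu>))) * gaussian_density \<mu> S u)"
    by (rule integrable_mult_quadratic_growth[OF _ _ second _ C])
      (use total pos in \<open>simp_all add: has_bochner_integral_iff less_imp_le borel_measurable_quadratic_form\<close>)
  then have "integrable lborel (\<lambda>u. - (1 / 2) * (((u - \<mu>) \<bullet> (matrix_inv S *v (u - \<mu>))) * gaussian_density \<mu> S u)
      - (CARD('n) * ln (2 * pi) + ln (det S)) / 2 * gaussian_density \<mu> S u)"
    using total by (intro Bochner_Integration.integrable_diff integrable_mult_right)
      (simp_all add: has_bochner_integral_iff)
  moreover have "- (1 / 2) * (((u - \<mu>) \<bullet> (matrix_inv S *v (u - \<mu>))) * gaussian_density \<mu> S u)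
      - (CARD('n) * ln (2 * pi) + ln (det S)) / 2 * gaussian_density \<mu> S u =
      gaussian_density \<mu> S u * ln (gaussian_density \<mu> S u)" for u
    unfolding ln_gaussian_density[OF S] by (simp only: mult.commute mult.left_commute right_diff_distrib)
  ultimately have "integrable lborel (\<lambda>u. gaussian_density \<mu> S u * ln (gaussian_density \<mu> S u))"
    by simp
  then show ?thesis
    using total second pos by (simp add: policies_def less_imp_le)
qed

text \<open>The bound \<open>ln z \<le> z - 1\<close> at \<open>z = p u / q u\<close>, multiplied by
  \<open>q u\<close>, integrates to a difference of two total masses.\<close>

lemma gibbs_inequality:
  assumes p: "p \<in> policies" and q: "q \<in> policies" and pos: "\<And>u. 0 < p u"
    and pq: "integrable lborel (\<lambda>u. ln (p u) * q u)"
  shows "(LINT u|lborel. (ln (p u) - ln (q u)) * q u) \<le> 0"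
proof -
  have int: "integrable lborel p" "integrable lborel q" "integrable lborel (\<lambda>u. ln (q u) * q u)"
    and one: "integral\<^sup>L lborel p = 1" "integral\<^sup>L lborel q = 1"
    using p q by (auto simp: policies_def has_bochner_integral_iff mult.commute)
  have "(LINT u|lborel. (ln (p u) - ln (q u)) * q u) \<le> (LINT u|lborel. p u - q u)"
  proof (rule integral_mono)
    show "integrable lborel (\<lambda>u. (ln (p u) - ln (q u)) * q u)"
      using pq int by (simp add: left_diff_distrib)
    fix u
    have "0 \<le> q u" using q by (simp add: policies_def)
    \<comment> \<open>Where \<open>q u\<close> vanishes, the factor \<open>q u\<close> annihilates
      the left side, whatever value \<open>ln 0\<close> has, and \<open>p u\<close> is
      positive.\<close>
    then consider "q u = 0" | "0 < q u" by linarith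
    then show "(ln (p u) - ln (q u)) * q u \<le> p u - q u"
    proof cases
      case 2
      have "ln (p u) - ln (q u) \<le> p u / q u - 1"
        using ln_le_minus_one[of "p u / q u"] pos[of u] 2 by (simp add: ln_div)
      then have "(ln (p u) - ln (q u)) * q u \<le> (p u / q u - 1) * q u"
        using 2 by (intro mult_right_mono) auto
      then show ?thesis using 2 by (simp add: left_diff_distrib)
    qed (use pos[of u] in simp)
  qed (use int in simp)
  then show ?thesis using int one by simp
qed

text \<open>The reward minus \<open>\<gamma>\<close> times the log-density of the Gaussian is constant, so that the
  deficit of any other policy is \<open>\<gamma>\<close> times its relative entropy with respect to the Gaussian.\<close>

proposition gaussian_maximizes_entropic_reward:
  fixes R :: "real ^ 'n ^ 'n"
  assumes R: "pos_def R" and "0 < \<gamma>"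
    and h: "\<And>u. h u = a - (u - \<mu>) \<bullet> (R *v (u - \<mu>))"
  defines "p \<equiv> gaussian_density \<mu> ((\<gamma> / 2) *\<^sub>R matrix_inv R)"
    and "c \<equiv> \<gamma> / 2 * (CARD('n) * ln (pi * \<gamma>) - ln (det R))"
  shows "p \<in> policies"
    and "(LINT u|lborel. (h u - \<gamma> * ln (p u)) * p u) = a + c"
    and "q \<in> policies \<Longrightarrow> (LINT u|lborel. (h u - \<gamma> * ln (q u)) * q u) \<le> a + c"
proof -
  let ?S = "(\<gamma> / 2) *\<^sub>R matrix_inv R"
  have S: "pos_def ?S"
    using \<open>0 < \<gamma>\<close> by (intro pos_def_scaleR pos_def_matrix_inv R) simp
  have detR: "0 < det R" using pos_def_det_pos[OF R] .
  have "det R * det (matrix_inv R) = 1"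
    using matrix_inv(1)[of R] detR by (simp flip: det_mul)
  then have "det (matrix_inv R) = 1 / det R"
    using detR by (simp add: field_simps)
  then have "ln (det ?S) = CARD('n) * ln (\<gamma> / 2) - ln (det R)"
    using detR \<open>0 < \<gamma>\<close> by (simp add: det_scaleR ln_mult ln_div ln_realpow)
  moreover have "ln (\<gamma> / 2) + ln (2 * pi) = ln (pi * \<gamma>)"
    using \<open>0 < \<gamma>\<close> by (simp add: ln_div ln_mult)
  ultimately have const: "CARD('n) * ln (2 * pi) + ln (det ?S) = CARD('n) * ln (pi * \<gamma>) - ln (det R)"
    by (smt (verit) distrib_left)
  have "?S ** ((2 / \<gamma>) *\<^sub>R R) = mat 1"
    using matrix_inv(2)[of R] detR \<open>0 < \<gamma>\<close> by (simp add: matrix_scalar_ac flip: scalar_matrix_assoc)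
  then have inv: "matrix_inv ?S = (2 / \<gamma>) *\<^sub>R R"
    by (rule matrix_inv_unique)
  \<comment> \<open>By \<open>const\<close>, the number \<open>c\<close> is \<gamma> times the
    logarithm of the normalizing constant; by \<open>inv\<close>, the exponent of \<open>p\<close>
    is the quadratic form divided by \<gamma>.\<close>
  have ln_p: "h u = a + c + \<gamma> * ln (p u)" for u
    unfolding p_def ln_gaussian_density[OF S] const inv h c_def
    using \<open>0 < \<gamma>\<close> by (simp add: scaleR_matrix_mult_vector field_simps)
  show p: "p \<in> policies"
    unfolding p_def using S by (rule gaussian_density_in_policies)
  \<comment> \<open>By \<open>ln_p\<close> the bracket is the constant \<open>a + c\<close>, and
    \<open>p\<close> has mass one.\<close>
  then show "(LINT u|lborel. (h u - \<gamma> * ln (p u)) * p u) = a + c"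
    by (simp add: ln_p policies_def has_bochner_integral_iff)
  show "(LINT u|lborel. (h u - \<gamma> * ln (q u)) * q u) \<le> a + c" if q: "q \<in> policies"
  proof -
    have int: "integrable lborel q" "integral\<^sup>L lborel q = 1" "integrable lborel (\<lambda>u. ln (q u) * q u)"
      using q by (auto simp: policies_def has_bochner_integral_iff mult.commute)
    obtain C where C: "\<And>u. \<bar>(u - \<mu>) \<bullet> (R *v (u - \<mu>))\<bar> \<le> C * (1 + (norm u)\<^sup>2)"
      using quadratic_form_growth by blast
    have "integrable lborel (\<lambda>u. ((u - \<mu>) \<bullet> (R *v (u - \<mu>))) * q u)"
      by (rule integrable_mult_quadratic_growth[OF _ int(1) _ _ C])
        (use q in \<open>simp_all add: policies_def borel_measurable_quadratic_form\<close>)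
    \<comment> \<open>Solving \<open>ln_p\<close> for the log-density turns the second moment of
      \<open>q\<close> into the integrability needed for \<open>gibbs_inequality\<close>.\<close>
    then have "integrable lborel (\<lambda>u. - (1 / \<gamma>) * (((u - \<mu>) \<bullet> (R *v (u - \<mu>))) * q u) - c / \<gamma> * q u)"
      using int by (intro Bochner_Integration.integrable_diff integrable_mult_right)
    moreover have "- (1 / \<gamma>) * (((u - \<mu>) \<bullet> (R *v (u - \<mu>))) * q u) - c / \<gamma> * q u = ln (p u) * q u" for u
    proof -
      have "ln (p u) = - (1 / \<gamma>) * ((u - \<mu>) \<bullet> (R *v (u - \<mu>))) - c / \<gamma>"
        using ln_p[of u] h[of u] \<open>0 < \<gamma>\<close> by (simp add: field_simps)
      then show ?thesis by (simp add: left_diff_distrib)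
    qed
    ultimately have pq: "integrable lborel (\<lambda>u. ln (p u) * q u)"
      by simp
    have "(LINT u|lborel. (h u - \<gamma> * ln (q u)) * q u) =
        (LINT u|lborel. (a + c) * q u + \<gamma> * ((ln (p u) - ln (q u)) * q u))"
      by (simp add: ln_p algebra_simps)
    also have "\<dots> = (a + c) + \<gamma> * (LINT u|lborel. (ln (p u) - ln (q u)) * q u)"
      using int pq by (subst Bochner_Integration.integral_add) (auto simp: left_diff_distrib)
    also have "\<dots> \<le> a + c"
      using gibbs_inequality[OF p q _ pq] gaussian_density_pos[OF S] \<open>0 < \<gamma>\<close>
      by (simp add: p_def mult_nonneg_nonpos)
    finally show ?thesis .
  qed
qed

subsection \<open>Quadratic value functions\<close>

lemma sym_mat_add: "sym_mat A \<Longrightarrow> sym_mat B \<Longrightarrow> sym_mat (A + B)"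
  and sym_mat_diff: "sym_mat A \<Longrightarrow> sym_mat B \<Longrightarrow> sym_mat (A - B)"
  and sym_mat_scaleR: "sym_mat A \<Longrightarrow> sym_mat (k *\<^sub>R A)"
  by (auto simp: sym_mat_def transpose_def vec_eq_iff)

lemma sym_mat_congruence:
  assumes "sym_mat S"
  shows "sym_mat (transpose C ** S ** C)"
  using assms by (simp add: sym_mat_def matrix_transpose_mul matrix_mul_assoc)

text \<open>Evaluation at 0 isolates \<open>e\<close>; polarization then recovers the bilinear form.
  Symmetry is essential, since an antisymmetric matrix has vanishing quadratic form.\<close>

lemma quadratic_polynomial_eq_0_iff:
  fixes S :: "real ^ 'n ^ 'n"
  assumes S: "sym_mat S"
  shows "(\<forall>x. x \<bullet> (S *v x) + e = 0) \<longleftrightarrow> S = 0 \<and> e = 0"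
proof
  assume zero: "\<forall>x. x \<bullet> (S *v x) + e = 0"
  from zero[rule_format, of 0] have "e = 0" by simp
  with zero have quad: "x \<bullet> (S *v x) = 0" for x by simp
  have "y \<bullet> (S *v x) = 0" for x y
    using quad[of "x + y"] quad[of x] quad[of y] inner_sym_mat[OF S, of x y]
    by (simp add: matrix_vector_right_distrib inner_add_left inner_add_right)
  then have "S *v x = 0 *v x" for x
    by (metis inner_eq_zero_iff matrix_vector_mult_0)
  then show "S = 0 \<and> e = 0"
    using \<open>e = 0\<close> by (simp add: matrix_eq)
qed simp

section \<open>Derivatives and jumps of a quadratic function\<close>

lemma GDERIV_unique:
  assumes "GDERIV f x :> D" and "GDERIV f x :> E"
  shows "D = E"
proof -
  have "(\<lambda>h. inner h D) = (\<lambda>h. inner h E)"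
    using assms unfolding gderiv_def by (rule has_derivative_unique)
  then show ?thesis by (metis vector_eq_ldot)
qed

lemma gradient_quadratic:
  fixes S :: "real ^ 'n ^ 'n"
  assumes S: "sym_mat S"
  shows "gradient (\<lambda>x. x \<bullet> (S *v x) + c) = (\<lambda>x. (2 *\<^sub>R S) *v x)"
proof
  fix x
  have "GDERIV (\<lambda>x. x \<bullet> (S *v x) + c) x :> (2 *\<^sub>R S) *v x"
    unfolding gderiv_def
  proof (rule has_derivative_eq_rhs)
    show "((\<lambda>x. x \<bullet> (S *v x) + c) has_derivative (\<lambda>h. (x \<bullet> (S *v h) + h \<bullet> (S *v x)) + 0)) (at x)"
      by (intro has_derivative_add has_derivative_inner has_derivative_const has_derivative_ident
          bounded_linear_imp_has_derivative matrix_vector_mul_bounded_linear)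
    show "(\<lambda>h. x \<bullet> (S *v h) + h \<bullet> (S *v x) + 0) = (\<lambda>h. h \<bullet> ((2 *\<^sub>R S) *v x))"
      using inner_sym_mat[OF S, of x] by (simp add: fun_eq_iff scaleR_matrix_mult_vector)
  qed
  then show "gradient (\<lambda>x. x \<bullet> (S *v x) + c) x = (2 *\<^sub>R S) *v x"
    unfolding gradient_def by (metis GDERIV_unique the_equality)
qed

lemma hessian_quadratic:
  fixes S :: "real ^ 'n ^ 'n"
  assumes S: "sym_mat S"
  shows "hessian (\<lambda>x. x \<bullet> (S *v x) + c) x = 2 *\<^sub>R S"
proof -
  have "((\<lambda>x. (2 *\<^sub>R S) *v x) has_derivative (\<lambda>x. (2 *\<^sub>R S) *v x)) (at x)"
    by (rule bounded_linear_imp_has_derivative) (rule matrix_vector_mul_bounded_linear)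
  then have "frechet_derivative (\<lambda>x. (2 *\<^sub>R S) *v x) (at x) = (\<lambda>x. (2 *\<^sub>R S) *v x)"
    by (rule frechet_derivative_at[symmetric])
  then show ?thesis
    unfolding hessian_def gradient_quadratic[OF S] jacobian_def by simp
qed

text \<open>The compensator cancels exactly the part linear in \<open>x\<close>. The remainder is
  free of \<open>x\<close>, which is why jumps enter only the equation for the offset.\<close>

lemma quadratic_jump:
  fixes S :: "real ^ 'n ^ 'n"
  assumes S: "sym_mat S"
  shows "(x + a *\<^sub>R axis i 1) \<bullet> (S *v (x + a *\<^sub>R axis i 1)) - x \<bullet> (S *v x)
    - a * ((2 *\<^sub>R S) *v x) $ i = a\<^sup>2 * S $ i $ i"
proof -
  have "axis i 1 \<bullet> (S *v x) = (S *v x) $ i" for x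
    by (simp add: inner_axis')
  moreover have "(S *v axis i 1) $ i = S $ i $ i"
    by (simp add: matrix_vector_mult_basis column_def)
  ultimately show ?thesis
    using inner_sym_mat[OF S, of x "axis i 1"]
    by (simp add: matrix_vector_right_distrib matrix_vector_mult_scaleR scaleR_matrix_mult_vector
        inner_add_left inner_add_right power2_eq_square algebra_simps)
qed

lemma trace_jump:
  fixes S :: "real ^ 'n ^ 'n"
  shows "trace (diag_mat l ** diag_mat a ** S ** diag_mat a) = (\<Sum>i\<in>UNIV. l $ i * ((a $ i)\<^sup>2 * S $ i $ i))"
proof -
  have left: "(diag_mat v ** A) $ i $ j = v $ i * A $ i $ j" for v and A :: "real ^ 'n ^ 'n" and i j
    by (simp add: diag_mat_def matrix_matrix_mult_def if_distrib[where f = "\<lambda>y. y * _"] cong: if_cong)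
  have right: "(A ** diag_mat v) $ i $ j = A $ i $ j * v $ j" for v and A :: "real ^ 'n ^ 'n" and i j
    by (simp add: diag_mat_def matrix_matrix_mult_def if_distrib[where f = "\<lambda>y. _ * y"] cong: if_cong)
  have "(diag_mat l ** diag_mat a ** S ** diag_mat a) $ i $ i = l $ i * ((a $ i)\<^sup>2 * S $ i $ i)" for i
    unfolding right matrix_mul_assoc[symmetric] left by (simp add: power2_eq_square)
  then show ?thesis by (simp add: trace_def)
qed

section \<open>The Hamiltonian of a quadratic value function\<close>

definition quadratic_gain ::
  "('d::finite, 'm::finite) lq_problem \<Rightarrow> (real \<Rightarrow> real ^ 'd ^ 'd) \<Rightarrow> real \<Rightarrow> real ^ 'd ^ 'd" where
  "quadratic_gain P H t =
     H t ** ctrl_mat P t ** matrix_inv (ctrl_cost P t) ** transpose (ctrl_mat P t) ** H t - state_cost P t"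

text \<open>With \<open>quadratic_gain\<close>, these are the two coefficients of the maximized
  Hamiltonian as a polynomial in \<open>x\<close>. The Riccati equation says that the derivative of
  \<open>H\<close> is \<beta> times \<open>H\<close> minus \<open>quadratic_gain\<close>; the offset
  equation has the same shape with \<open>noise_gain\<close> and \<open>c\<close>.\<close>

definition noise_gain ::
  "('d::finite, 'm::finite) lq_problem \<Rightarrow> (real \<Rightarrow> real ^ 'd ^ 'd) \<Rightarrow> real \<Rightarrow> real" where
  "noise_gain P H t =
     trace (diff_mat P t ** transpose (diff_mat P t) ** H t)
     + trace (diag_mat (jump_rate P t) ** diag_mat (jump_size P t) ** H t ** diag_mat (jump_size P t))"

lemma hamiltonian_quad_value:
  assumes R: "pos_def (ctrl_cost P t)" and H: "sym_mat (H t)"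
  shows "hamiltonian P (quad_value H g) t x u =
    x \<bullet> (quadratic_gain P H t *v x) + noise_gain P H t
    - (u - feedback P H t x) \<bullet> (ctrl_cost P t *v (u - feedback P H t x))"
proof -
  let ?R = "ctrl_cost P t" and ?B = "ctrl_mat P t" and ?\<mu> = "feedback P H t x"
  have V: "quad_value H g t = (\<lambda>x. x \<bullet> (H t *v x) + g t)"
    by (simp add: fun_eq_iff quad_value_def)
  have "det ?R \<noteq> 0" using pos_def_det_pos[OF R] by simp
  note inv = matrix_inv[OF this]
  have symR: "sym_mat ?R" using R by (simp add: pos_def_def)
  \<comment> \<open>The characterization of the feedback: it turns the drift term, linear in
    \<open>u\<close>, into the cross term of a square in the form
    \<open>ctrl_cost P t\<close>.\<close>
  have R\<mu>: "?R *v ?\<mu> = transpose ?B *v (H t *v x)"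
    by (simp add: feedback_def matrix_vector_mul_assoc matrix_mul_assoc inv del: transpose_matrix_vector)
  have "x \<bullet> ((H t ** ?B ** matrix_inv ?R ** transpose ?B ** H t) *v x) = x \<bullet> (H t *v (?B *v ?\<mu>))"
    by (simp add: feedback_def matrix_vector_mul_assoc matrix_mul_assoc del: transpose_matrix_vector)
  also have "\<dots> = (?B *v ?\<mu>) \<bullet> (H t *v x)"
    by (rule inner_sym_mat[OF H])
  also have "\<dots> = ?\<mu> \<bullet> (?R *v ?\<mu>)"
    unfolding R\<mu> by (rule inner_transpose_mult[symmetric])
  finally have gain: "x \<bullet> (quadratic_gain P H t *v x) = ?\<mu> \<bullet> (?R *v ?\<mu>) - x \<bullet> (state_cost P t *v x)"
    by (simp add: quadratic_gain_def matrix_vector_mult_diff_rdistrib inner_diff_right)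
  have "(?B *v u) \<bullet> ((2 *\<^sub>R H t) *v x) = 2 * (u \<bullet> (?R *v ?\<mu>))"
    unfolding R\<mu> inner_transpose_mult by (simp add: scaleR_matrix_mult_vector)
  moreover have "(u - ?\<mu>) \<bullet> (?R *v (u - ?\<mu>)) = u \<bullet> (?R *v u) - 2 * (u \<bullet> (?R *v ?\<mu>)) + ?\<mu> \<bullet> (?R *v ?\<mu>)"
    using inner_sym_mat[OF symR, of u ?\<mu>]
    by (simp add: matrix_vector_mult_diff_distrib inner_diff_left inner_diff_right)
  \<comment> \<open>The Hessian of the form is twice \<open>H t\<close>, which cancels the factor
    one half.\<close>
  moreover have "1 / 2 * trace (diff_mat P t ** transpose (diff_mat P t) ** (2 *\<^sub>R H t)) =
      trace (diff_mat P t ** transpose (diff_mat P t) ** H t)"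
    by (simp add: trace_def matrix_scalar_ac sum_distrib_left flip: scalar_matrix_assoc)
  moreover have "(\<Sum>i\<in>UNIV. jump_rate P t $ i *
      (quad_value H g t (x + jump_size P t $ i *\<^sub>R axis i 1) - quad_value H g t x
        - jump_size P t $ i * ((2 *\<^sub>R H t) *v x) $ i)) =
      trace (diag_mat (jump_rate P t) ** diag_mat (jump_size P t) ** H t ** diag_mat (jump_size P t))"
    unfolding trace_jump using quadratic_jump[OF H, of x]
    by (intro sum.cong refl) (simp add: quad_value_def)
  ultimately show ?thesis
    unfolding hamiltonian_def running_reward_def V gradient_quadratic[OF H] hessian_quadratic[OF H]
    unfolding V[symmetric] by (simp add: gain noise_gain_def)
qed

section \<open>Time derivatives on the half-line and the HJB equation\<close>

lemma at_within_atLeast_neq_bot: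
  fixes t :: real
  assumes "0 \<le> t"
  shows "at t within {0..} \<noteq> bot"
proof -
  have "t islimpt {t<..<t + 1}" by (simp add: islimpt_greaterThanLessThan1)
  then have "t islimpt {0..}" by (rule islimpt_subset) (use assms in auto)
  then show ?thesis by (simp add: trivial_limit_within)
qed

text \<open>Transposition is linear and fixes the path on \<open>{0..}\<close>, so the transpose of
  \<open>D\<close> is a derivative of the same path; uniqueness, one-sided at time 0, identifies it
  with \<open>D\<close>.\<close>

lemma sym_mat_vector_derivative:
  assumes D: "(H has_vector_derivative D) (at t within {0..})" and "0 \<le> t"
    and sym: "\<And>t. 0 \<le> t \<Longrightarrow> sym_mat (H t)"
  shows "sym_mat D"
proof -
  have "linear (transpose :: real ^ 'n ^ 'n \<Rightarrow> _)"
    by (rule linearI) (auto simp: transpose_def vec_eq_iff)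
  then have "((\<lambda>s. transpose (H s)) has_vector_derivative transpose D) (at t within {0..})"
    using D unfolding linear_conv_bounded_linear by (rule bounded_linear.has_vector_derivative)
  then have "(H has_vector_derivative transpose D) (at t within {0..})"
    by (rule has_vector_derivative_transform[rotated 2]) (use sym \<open>0 \<le> t\<close> in \<open>auto simp: sym_mat_def\<close>)
  then show ?thesis
    unfolding sym_mat_def
    using D at_within_atLeast_neq_bot[OF \<open>0 \<le> t\<close>] vector_derivative_unique_within by blast
qed

lemma time_deriv_quad_value:
  assumes H: "(H has_vector_derivative D) (at t within {0..})"
    and g: "(g has_vector_derivative e) (at t within {0..})" and "0 \<le> t"
  shows "time_deriv (quad_value H g) t x = x \<bullet> (D *v x) + e"
proof -
  have "linear (\<lambda>A :: real ^ 'a ^ 'a. x \<bullet> (A *v x))"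
    by (rule linearI)
      (simp_all add: matrix_vector_mult_add_rdistrib inner_add_right scaleR_matrix_mult_vector)
  then have "((\<lambda>s. x \<bullet> (H s *v x)) has_vector_derivative x \<bullet> (D *v x)) (at t within {0..})"
    using H unfolding linear_conv_bounded_linear by (rule bounded_linear.has_vector_derivative)
  then have "((\<lambda>s. quad_value H g s x) has_vector_derivative x \<bullet> (D *v x) + e) (at t within {0..})"
    unfolding quad_value_def using g by (rule has_vector_derivative_add)
  then show ?thesis
    unfolding time_deriv_def
    using at_within_atLeast_neq_bot[OF \<open>0 \<le> t\<close>] by (rule vector_derivative_within[rotated])
qed

text \<open>Serves both cases: \<open>s\<close> stands for either supremum, and \<open>c\<close> for
  the entropy constant or zero.\<close>

proposition HJB_quad_value_iff:
  assumes wf: "lq_wf P" and sym: "\<And>t. 0 \<le> t \<Longrightarrow> sym_mat (H t)"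
    and "cont_diff H" and "cont_diff g"
    and sup: "\<And>t x. 0 \<le> t \<Longrightarrow>
      s t x = ereal (x \<bullet> (quadratic_gain P H t *v x) + noise_gain P H t + c t)"
  shows "(\<forall>t\<ge>0. \<forall>x. 0 = ereal (time_deriv (quad_value H g) t x) + s t x - ereal (\<beta> * quad_value H g t x))
    \<longleftrightarrow> riccati_eq P \<beta> H \<and> offset_eq P \<beta> c H g"
proof -
  obtain H' where H': "\<And>t. 0 \<le> t \<Longrightarrow> (H has_vector_derivative H' t) (at t within {0..})"
    using \<open>cont_diff H\<close> by (auto simp: cont_diff_def)
  obtain g' where g': "\<And>t. 0 \<le> t \<Longrightarrow> (g has_vector_derivative g' t) (at t within {0..})"
    using \<open>cont_diff g\<close> by (auto simp: cont_diff_def)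
  \<comment> \<open>\<open>S\<close> and \<open>e\<close> are the residuals of the Riccati and
    offset equations, and the coefficients in \<open>x\<close> of the HJB residual.\<close>
  define S where "S t = H' t + quadratic_gain P H t - \<beta> *\<^sub>R H t" for t
  define e where "e t = g' t + noise_gain P H t + c t - \<beta> * g t" for t
  have symS: "sym_mat (S t)" if t: "0 \<le> t" for t
  proof -
    have "pos_def (ctrl_cost P t)" and Q: "sym_mat (state_cost P t)"
      using wf t by (auto simp: lq_wf_def pos_semidef_def)
    then have "sym_mat (matrix_inv (ctrl_cost P t))"
      using pos_def_matrix_inv pos_def_def by blast
    \<comment> \<open>By symmetry of \<open>H t\<close>, the quadratic gain is a congruence of the
      inverse cost matrix, up to subtracting \<open>state_cost P t\<close>.\<close>
    from sym_mat_congruence[OF this, of "transpose (ctrl_mat P t) ** H t"] sym[OF t]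
    have "sym_mat (H t ** ctrl_mat P t ** matrix_inv (ctrl_cost P t) ** transpose (ctrl_mat P t) ** H t)"
      by (simp add: matrix_transpose_mul matrix_mul_assoc sym_mat_def)
    then show ?thesis
      unfolding S_def quadratic_gain_def
      by (intro sym_mat_add sym_mat_diff sym_mat_scaleR Q sym[OF t]
          sym_mat_vector_derivative[OF H'[OF t] t sym])
  qed
  have hjb: "0 = ereal (time_deriv (quad_value H g) t x) + s t x - ereal (\<beta> * quad_value H g t x)
      \<longleftrightarrow> x \<bullet> (S t *v x) + e t = 0" if t: "0 \<le> t" for t x
  proof -
    have "x \<bullet> (S t *v x) = x \<bullet> (H' t *v x) + x \<bullet> (quadratic_gain P H t *v x) - \<beta> * (x \<bullet> (H t *v x))"
      by (simp add: S_def matrix_vector_mult_add_rdistrib matrix_vector_mult_diff_rdistrib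
          scaleR_matrix_mult_vector inner_add_right inner_diff_right)
    then have "time_deriv (quad_value H g) t x + (x \<bullet> (quadratic_gain P H t *v x) + noise_gain P H t + c t)
        - \<beta> * quad_value H g t x = x \<bullet> (S t *v x) + e t"
      unfolding time_deriv_quad_value[OF H'[OF t] g'[OF t] t] e_def quad_value_def
      by (simp add: distrib_left)
    \<comment> \<open>Every term is finite, so the extended-real equation is a real one.\<close>
    then show ?thesis
      by (simp only: sup[OF t] plus_ereal.simps ereal_minus ereal_eq_0)
  qed
  \<comment> \<open>Differentiability is given by \<open>cont_diff\<close>, so by uniqueness each
    differential equation is pointwise an equation between values.\<close>
  have riccati: "(H has_vector_derivative D) (at t within {0..}) \<longleftrightarrow> H' t = D" if "0 \<le> t" for t D
    using H'[OF that] at_within_atLeast_neq_bot[OF that] vector_derivative_unique_within by blast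
  have offset: "(g has_real_derivative D) (at t within {0..}) \<longleftrightarrow> g' t = D" if "0 \<le> t" for t D
    unfolding has_real_derivative_iff_has_vector_derivative
    using g'[OF that] at_within_atLeast_neq_bot[OF that] vector_derivative_unique_within by blast
  have "riccati_eq P \<beta> H \<longleftrightarrow> (\<forall>t\<ge>0. S t = 0)"
    unfolding riccati_eq_def S_def quadratic_gain_def by (auto simp: riccati algebra_simps)
  moreover have "offset_eq P \<beta> c H g \<longleftrightarrow> (\<forall>t\<ge>0. e t = 0)"
    unfolding offset_eq_def e_def noise_gain_def by (auto simp: offset algebra_simps)
  ultimately show ?thesis
    using hjb quadratic_polynomial_eq_0_iff[OF symS] by auto
qed

theorem mainTheorem3:
  fixes P :: "('d::finite, 'm::finite) lq_problem"
    and \<beta> \<gamma> :: real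
    and H :: "real \<Rightarrow> real ^ 'd ^ 'd"
    and g :: "real \<Rightarrow> real"
  assumes "lq_wf P"
    and "\<beta> > 0" and "\<gamma> \<ge> 0"
    and "\<And>t. t \<ge> 0 \<Longrightarrow> sym_mat (H t)"
    and "cont_diff H" and "cont_diff g"
  shows
    "(\<gamma> > 0 \<longrightarrow>
        (\<forall>t\<ge>0. \<forall>x.
           (let p = gaussian_density (feedback P H t x) ((\<gamma> / 2) *\<^sub>R matrix_inv (ctrl_cost P t))
            in p \<in> policies
               \<and> policy_sup P \<gamma> (quad_value H g) t x = ereal (policy_value P \<gamma> (quad_value H g) t x p)))
        \<and> (entropy_HJB P \<beta> \<gamma> (quad_value H g)
             \<longleftrightarrow> riccati_eq P \<beta> H \<and> offset_eq P \<beta> (entropy_const P \<gamma>) H g))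
     \<and> (\<gamma> = 0 \<longrightarrow>
        (\<forall>t\<ge>0. \<forall>x.
           control_sup P (quad_value H g) t x
             = ereal (hamiltonian P (quad_value H g) t x (feedback P H t x)))
        \<and> (standard_HJB P \<beta> (quad_value H g)
             \<longleftrightarrow> riccati_eq P \<beta> H \<and> offset_eq P \<beta> (\<lambda>t. 0) H g))"
proof (intro conjI impI)
  note wf = assms(1) and sym = assms(4)
  have R: "pos_def (ctrl_cost P t)" if "0 \<le> t" for t
    using wf that by (simp add: lq_wf_def)
  let ?V = "quad_value H g"
  let ?a = "\<lambda>t x. x \<bullet> (quadratic_gain P H t *v x) + noise_gain P H t"
  let ?\<pi> = "\<lambda>t x. gaussian_density (feedback P H t x) ((\<gamma> / 2) *\<^sub>R matrix_inv (ctrl_cost P t))"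
  {
    assume "0 < \<gamma>"
    have opt: "?\<pi> t x \<in> policies"
      "policy_value P \<gamma> ?V t x (?\<pi> t x) = ?a t x + entropy_const P \<gamma> t"
      "\<And>q. q \<in> policies \<Longrightarrow> policy_value P \<gamma> ?V t x q \<le> ?a t x + entropy_const P \<gamma> t"
      if t: "0 \<le> t" for t x
      using gaussian_maximizes_entropic_reward[OF R[OF t] \<open>0 < \<gamma>\<close>,
          of "hamiltonian P ?V t x" "?a t x" "feedback P H t x",
          OF hamiltonian_quad_value[where H = H and g = g, OF R[OF t] sym[OF t]]]
      unfolding policy_value_def entropy_const_def by blast+
    have attained: "policy_sup P \<gamma> ?V t x = ereal (policy_value P \<gamma> ?V t x (?\<pi> t x))" if t: "0 \<le> t" for t x
      unfolding policy_sup_def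
    proof (rule SUP_eqI)
      show "ereal (policy_value P \<gamma> ?V t x q) \<le> ereal (policy_value P \<gamma> ?V t x (?\<pi> t x))"
        if "q \<in> policies" for q
        using opt(3)[OF t that] opt(2)[OF t] by simp
    qed (use opt(1)[OF t] in blast)
    show "\<forall>t\<ge>0. \<forall>x. let p = ?\<pi> t x in p \<in> policies
        \<and> policy_sup P \<gamma> ?V t x = ereal (policy_value P \<gamma> ?V t x p)"
      using opt(1) attained by (simp add: Let_def)
    \<comment> \<open>The maximum becomes an explicit polynomial in \<open>x\<close>, as
      \<open>HJB_quad_value_iff\<close> requires.\<close>
    have "policy_sup P \<gamma> ?V t x = ereal (?a t x + entropy_const P \<gamma> t)" if t: "0 \<le> t" for t x
      using attained[OF t] opt(2)[OF t] by simp
    then show "entropy_HJB P \<beta> \<gamma> ?V \<longleftrightarrow> riccati_eq P \<beta> H \<and> offset_eq P \<beta> (entropy_const P \<gamma>) H g"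
      unfolding entropy_HJB_def by (intro HJB_quad_value_iff[where s = "policy_sup P \<gamma> ?V"] wf sym assms(5,6))
  }
  have max: "hamiltonian P ?V t x (feedback P H t x) = ?a t x"
    "hamiltonian P ?V t x u \<le> ?a t x" if t: "0 \<le> t" for t x u
  proof -
    have "0 \<le> v \<bullet> (ctrl_cost P t *v v)" for v
      using R[OF t] by (cases "v = 0") (auto simp: pos_def_def less_imp_le)
    then show "hamiltonian P ?V t x (feedback P H t x) = ?a t x" "hamiltonian P ?V t x u \<le> ?a t x"
      by (simp_all add: hamiltonian_quad_value[where H = H and g = g, OF R[OF t] sym[OF t]])
  qed
  have attained: "control_sup P ?V t x = ereal (hamiltonian P ?V t x (feedback P H t x))" if "0 \<le> t" for t x
    unfolding control_sup_def max(1)[OF that]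
    by (rule SUP_eqI) (use max(2)[OF that] in simp, metis UNIV_I max(1)[OF that])
  then show "\<forall>t\<ge>0. \<forall>x. control_sup P ?V t x = ereal (hamiltonian P ?V t x (feedback P H t x))"
    by blast
  \<comment> \<open>The \<open>+ 0\<close> matches the constant \<open>c\<close> of
    \<open>HJB_quad_value_iff\<close>.\<close>
  have "control_sup P ?V t x = ereal (?a t x + 0)" if "0 \<le> t" for t x
    using attained[OF that] max(1)[OF that] by simp
  then show "standard_HJB P \<beta> ?V \<longleftrightarrow> riccati_eq P \<beta> H \<and> offset_eq P \<beta> (\<lambda>t. 0) H g"
    unfolding standard_HJB_def by (intro HJB_quad_value_iff[where s = "control_sup P ?V"] wf sym assms(5,6))
qed

end
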